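(* Let $S$ be an LA-semigroup with left identity $e$. If $S$ is left invertible, then $S$ is intra-regular. Likewise, if $S$ is right invertible, then $S$ is intra-regular.
   Context: An LA-semigroup (left almost semigroup) is a nonempty set $S$ with a binary operation, written as juxtaposition, satisfying the left invertive law $(ab)c=(cb)a$ for all $a,b,c\in S$ (associativity and commutativity are not assumed). A left identity is an element $e\in S$ with $ea=a$ for all $a\in S$. An LA-semigroup $S$ with left identity $e$ is left invertible if for every $a\in S$ there exists $x\in S$ with $xa=e$, and right invertible if for every $a\in S$ there exists $x\in S$ with $ax=e$. $S$ is intra-regular if for every $a\in S$ there exist $x,y\in S$ such that $a=(xa^{2})y$, where $a^2=aa$. *)

theory Defs
  imports Main
begin

locale la_semigroup =
  fixes S :: "'a set" and mult :: "'a \<Rightarrow> 'a \<Rightarrow> 'a" (infixl "\<cdot>" 70)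
  assumes nonempty: "S \<noteq> {}"
    and closed: "\<lbrakk>a \<in> S; b \<in> S\<rbrakk> \<Longrightarrow> a \<cdot> b \<in> S"
    and left_invertive: "\<lbrakk>a \<in> S; b \<in> S; c \<in> S\<rbrakk> \<Longrightarrow> (a \<cdot> b) \<cdot> c = (c \<cdot> b) \<cdot> a"

definition left_identity :: "'a set \<Rightarrow> ('a \<Rightarrow> 'a \<Rightarrow> 'a) \<Rightarrow> 'a \<Rightarrow> bool"
  where "left_identity S mult e \<longleftrightarrow> e \<in> S \<and> (\<forall>a\<in>S. e \<cdot> a = a)"
  for mult (infixl "\<cdot>" 70)

definition left_invertible :: "'a set \<Rightarrow> ('a \<Rightarrow> 'a \<Rightarrow> 'a) \<Rightarrow> 'a \<Rightarrow> bool"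
  where "left_invertible S mult e \<longleftrightarrow> (\<forall>a\<in>S. \<exists>x\<in>S. x \<cdot> a = e)"
  for mult (infixl "\<cdot>" 70)

definition right_invertible :: "'a set \<Rightarrow> ('a \<Rightarrow> 'a \<Rightarrow> 'a) \<Rightarrow> 'a \<Rightarrow> bool"
  where "right_invertible S mult e \<longleftrightarrow> (\<forall>a\<in>S. \<exists>x\<in>S. a \<cdot> x = e)"
  for mult (infixl "\<cdot>" 70)

definition intra_regular :: "'a set \<Rightarrow> ('a \<Rightarrow> 'a \<Rightarrow> 'a) \<Rightarrow> bool"
  where "intra_regular S mult \<longleftrightarrow> (\<forall>a\<in>S. \<exists>x\<in>S. \<exists>y\<in>S. a = (x \<cdot> (a \<cdot> a)) \<cdot> y)"
  for mult (infixl "\<cdot>" 70)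

end

theory Submission
  imports Defs
begin

text \<open>
  A left inverse \<open>x\<close> of the square \<open>a \<cdot> a\<close>, rather than of \<open>a\<close>, gives intra-regularity at once:
  \<open>(x \<cdot> (a \<cdot> a)) \<cdot> a = e \<cdot> a = a\<close>. The right invertible case reduces to this one, because
  the left invertive law can swap \<open>x\<close> and \<open>a\<close> once a factor \<open>e\<close> is put in front, which makes
  every right inverse a left inverse.
\<close>

lemma left_invertible_imp_intra_regular:
  fixes mult :: "'a \<Rightarrow> 'a \<Rightarrow> 'a" (infixl "\<cdot>" 70)
  assumes "la_semigroup S mult" and "left_identity S mult e" and "left_invertible S mult e"
  shows "intra_regular S mult"
  unfolding intra_regular_def
proof
  interpret la_semigroup S mult by fact
  fix a assume a: "a \<in> S"
  then obtain x where x: "x \<in> S" "x \<cdot> (a \<cdot> a) = e"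
    using assms(3) closed unfolding left_invertible_def by blast
  have "a = (x \<cdot> (a \<cdot> a)) \<cdot> a"
    using assms(2) a x(2) unfolding left_identity_def by simp
  with x(1) a show "\<exists>x\<in>S. \<exists>y\<in>S. a = (x \<cdot> (a \<cdot> a)) \<cdot> y" by blast
qed

lemma right_invertible_imp_left_invertible:
  fixes mult :: "'a \<Rightarrow> 'a \<Rightarrow> 'a" (infixl "\<cdot>" 70)
  assumes "la_semigroup S mult" and "left_identity S mult e" and "right_invertible S mult e"
  shows "left_invertible S mult e"
  unfolding left_invertible_def
proof
  interpret la_semigroup S mult by fact
  have e: "e \<in> S" "\<And>b. b \<in> S \<Longrightarrow> e \<cdot> b = b"
    using assms(2) unfolding left_identity_def by auto
  fix a assume a: "a \<in> S"
  then obtain x where x: "x \<in> S" "a \<cdot> x = e"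
    using assms(3) unfolding right_invertible_def by blast
  have "x \<cdot> a = (e \<cdot> x) \<cdot> a" using e(2) x(1) by simp
  also have "\<dots> = (a \<cdot> x) \<cdot> e" using left_invertive e(1) x(1) a by blast
  also have "\<dots> = e" using e x(2) by simp
  finally show "\<exists>x\<in>S. x \<cdot> a = e" using x(1) by blast
qed

theorem theorem1:
  fixes S :: "'a set" and mult :: "'a \<Rightarrow> 'a \<Rightarrow> 'a" and e :: 'a
  assumes "la_semigroup S mult"
    and "left_identity S mult e"
  shows "(left_invertible S mult e \<longrightarrow> intra_regular S mult)
    \<and> (right_invertible S mult e \<longrightarrow> intra_regular S mult)"
  using left_invertible_imp_intra_regular[OF assms]
    right_invertible_imp_left_invertible[OF assms] by blast

end
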